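(* Let $T:\ell_{\infty}^{2}(\mathbb{R})\times\ell_{\infty}^{2}(\mathbb{R})\to\mathbb{R}$ be given by $T(x,y)=\sum_{i,j=1}^{2}a_{ij}x_{i}y_{j}$, with $a_{ij}\in\mathbb{R}$. Then the bilinear forms satisfying $$\left(\sum_{j,k=1}^{2}|T(e_{j},e_{k})|^{\frac{4}{3}}\right)^{\frac{3}{4}}=\sqrt{2}\,\|T\|$$ are given by $$T(x,y)=\alpha x_{1}y_{1}+\alpha x_{1}y_{2}+\alpha x_{2}y_{1}-\alpha x_{2}y_{2}$$ or $$T(x,y)=\alpha x_{1}y_{1}+\alpha x_{1}y_{2}-\alpha x_{2}y_{1}+\alpha x_{2}y_{2}$$ or $$T(x,y)=\alpha x_{1}y_{1}-\alpha x_{1}y_{2}+\alpha x_{2}y_{1}+\alpha x_{2}y_{2}$$ or $$T(x,y)=-\alpha x_{1}y_{1}+\alpha x_{1}y_{2}+\alpha x_{2}y_{1}+\alpha x_{2}y_{2}$$ for all $\alpha\in\mathbb{R}\setminus\{0\}$.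
   Context: $\ell_\infty^2(\mathbb{R})$ is $\mathbb{R}^2$ with the sup norm, $x=(x_1,x_2)$ and $y=(y_1,y_2)$ are its elements, $e_1,e_2$ are the canonical basis vectors, and $\|T\|=\sup\{|T(x,y)|:\|x\|_\infty\le 1,\|y\|_\infty\le 1\}$.
   Formalization: The characterization is stated for nonzero T, since T = 0 satisfies the displayed equality (0 = 0) but belongs to none of the listed families with α ≠ 0. *)

theory Defs
  imports "HOL-Analysis.Analysis"
begin

text \<open>
  The type \<open>real ^ 'n\<close> carries the Euclidean norm, so the unit balls below are taken with respect
  to \<^const>\<open>infnorm\<close>, the sup norm. The supremum is meaningful for bilinear \<open>T\<close>, where the set is
  nonempty and bounded above.
\<close>

definition bilinear_form_norm :: "(real ^ 'm \<Rightarrow> real ^ 'n \<Rightarrow> real) \<Rightarrow> real" where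
  "bilinear_form_norm T = Sup {\<bar>T x y\<bar> | x y. infnorm x \<le> 1 \<and> infnorm y \<le> 1}"

end

theory Submission
  imports Defs
begin

text \<open>
  Writing \<open>M\<close> for the norm, averaging \<open>\<bar>T x y\<bar>\<close> over sign vectors shows that any two of the four
  numbers \<open>\<bar>a\<^sub>i\<^sub>j\<bar>\<close> have sum at most \<open>M\<close>. Hence at most one of them exceeds \<open>M / 2\<close>, and
  under these constraints the sum of their \<open>4 / 3\<close> powers is at most \<open>4 (M / 2)\<^sup>4\<^sup>/\<^sup>3\<close>, with equality only if all four equal \<open>M / 2\<close>.
  In that case the signs decide: with an even number of minus signs the form has norm \<open>2 M\<close> instead of \<open>M\<close>.
\<close>

lemma infnorm_le_iff_2: "infnorm x \<le> r \<longleftrightarrow> \<bar>x $ 1\<bar> \<le> r \<and> \<bar>x $ 2\<bar> \<le> r" for x :: "real ^ 2"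
proof -
  have "{\<bar>x $ i\<bar> |i. i \<in> UNIV} = {\<bar>x $ 1\<bar>, \<bar>x $ 2\<bar>}"
    by (auto simp: exhaust_2) (metis exhaust_2)
  then show ?thesis
    by (simp add: infnorm_cart cSup_insert)
qed

lemma abs_weighted_sum_le:
  fixes u v p q :: real
  assumes "\<bar>u\<bar> \<le> 1" "\<bar>v\<bar> \<le> 1"
  shows "\<bar>u * p + v * q\<bar> \<le> \<bar>p\<bar> + \<bar>q\<bar>"
proof -
  have "\<bar>u * p + v * q\<bar> \<le> \<bar>u\<bar> * \<bar>p\<bar> + \<bar>v\<bar> * \<bar>q\<bar>"
    by (metis abs_mult abs_triangle_ineq)
  also have "\<dots> \<le> \<bar>p\<bar> + \<bar>q\<bar>"
    using assms by (intro add_mono mult_left_le_one_le) auto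
  finally show ?thesis .
qed

text \<open>For fixed \<open>y\<close> the best \<open>x\<close> turns the form into \<open>\<bar>a
  * y $ 1 + b * y $ 2\<bar> + \<bar>c * y $ 1 + d * y $ 2\<bar>\<close>. This is convex and even in
  \<open>y\<close>, so only the corners (1, 1) and (1, -1) of the square matter; they give the two
  terms of the maximum.\<close>

lemma bilinear_form_norm_2:
  fixes T :: "real ^ 2 \<Rightarrow> real ^ 2 \<Rightarrow> real"
  assumes T: "\<And>x y. T x y = a * x $ 1 * y $ 1 + b * x $ 1 * y $ 2 + c * x $ 2 * y $ 1 + d * x $ 2 * y $ 2"
  shows "bilinear_form_norm T = max (\<bar>a + b\<bar> + \<bar>c + d\<bar>) (\<bar>a - b\<bar> + \<bar>c - d\<bar>)" (is "_ = ?M")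
  unfolding bilinear_form_norm_def
proof (rule cSup_eq_maximum)
  have attained: "\<bar>a + s * b\<bar> + \<bar>c + s * d\<bar> \<in> {\<bar>T x y\<bar> |x y. infnorm x \<le> 1 \<and> infnorm y \<le> 1}"
    if "\<bar>s\<bar> \<le> 1" for s
  proof -
    \<comment> \<open>The signs in \<open>x\<close> make both row contributions nonnegative, so that
      they add up without cancellation.\<close>
    define x :: "real ^ 2" where "x = vector [sgn (a + s * b), sgn (c + s * d)]"
    define y :: "real ^ 2" where "y = vector [1, s]"
    have "T x y = \<bar>a + s * b\<bar> + \<bar>c + s * d\<bar>"
      by (simp add: T x_def y_def abs_sgn algebra_simps)
    then have "\<bar>T x y\<bar> = \<bar>a + s * b\<bar> + \<bar>c + s * d\<bar>"
      by simp
    moreover have "infnorm x \<le> 1" "infnorm y \<le> 1"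
      using that by (auto simp: infnorm_le_iff_2 x_def y_def abs_sgn_eq)
    ultimately show ?thesis by (metis (mono_tags, lifting) mem_Collect_eq)
  qed
  from attained[of 1] attained[of "-1"]
  show "?M \<in> {\<bar>T x y\<bar> |x y. infnorm x \<le> 1 \<and> infnorm y \<le> 1}"
    unfolding max_def by (simp split: if_split)
next
  fix z assume "z \<in> {\<bar>T x y\<bar> |x y. infnorm x \<le> 1 \<and> infnorm y \<le> 1}"
  then obtain x y where z: "z = \<bar>T x y\<bar>"
    and x: "\<bar>x $ 1\<bar> \<le> 1" "\<bar>x $ 2\<bar> \<le> 1" and y: "\<bar>y $ 1\<bar> \<le> 1" "\<bar>y $ 2\<bar> \<le> 1"
    by (auto simp: infnorm_le_iff_2)
  define p where "p = x $ 1 * a + x $ 2 * c"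
  define q where "q = x $ 1 * b + x $ 2 * d"
  have "z = \<bar>y $ 1 * p + y $ 2 * q\<bar>"
    by (simp add: z T p_def q_def algebra_simps)
  \<comment> \<open>Uses \<open>\<bar>p\<bar> + \<bar>q\<bar> = max \<bar>p + q\<bar> \<bar>p -
    q\<bar>\<close>.\<close>
  also have "\<dots> \<le> max \<bar>p + q\<bar> \<bar>p - q\<bar>"
    using abs_weighted_sum_le[OF y, of p q] by linarith
  also have "\<dots> \<le> ?M"
  proof -
    have "p + q = x $ 1 * (a + b) + x $ 2 * (c + d)" "p - q = x $ 1 * (a - b) + x $ 2 * (c - d)"
      by (simp_all add: p_def q_def algebra_simps)
    then have "\<bar>p + q\<bar> \<le> \<bar>a + b\<bar> + \<bar>c + d\<bar>"
      "\<bar>p - q\<bar> \<le> \<bar>a - b\<bar> + \<bar>c - d\<bar>"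
      using abs_weighted_sum_le[OF x] by simp_all
    then show ?thesis by (rule max.mono)
  qed
  finally show "z \<le> ?M" .
qed

text \<open>A large \<open>p\<close> pushes the other three down to at most
  \<open>2 - p < 1\<close>, where the power 4/3 is below the identity. The sum is then less than
  \<open>p\<^sup>2 + 3 * (2 - p)\<close>, which is at most 4 for \<open>p\<close> between 1 and
  2.\<close>

lemma powr_four_thirds_sum_less:
  fixes p q r s :: real
  assumes "0 \<le> q" "0 \<le> r" "0 \<le> s" and "p + q \<le> 2" "p + r \<le> 2" "p + s \<le> 2" and "1 < p"
  shows "p powr (4/3) + q powr (4/3) + r powr (4/3) + s powr (4/3) < 4"
proof -
  have small: "t powr (4/3) \<le> 2 - p" if "0 \<le> t" "p + t \<le> 2" for t
  proof -
    have "t powr (4/3) \<le> t powr 1"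
      using that \<open>1 < p\<close> by (intro powr_mono') auto
    with that show ?thesis by simp
  qed
  have "p powr (4/3) < p powr 2"
    using \<open>1 < p\<close> by (intro powr_less_mono) auto
  also have "p powr 2 = p\<^sup>2"
    using \<open>1 < p\<close> by simp
  \<comment> \<open>On [1, 2] the parabola lies below its chord: the difference is
    \<open>(p - 1) * (2 - p)\<close>.\<close>
  also have "\<dots> \<le> 3 * p - 2"
    using mult_nonneg_nonneg[of "p - 1" "2 - p"] assms
    by (simp add: power2_eq_square algebra_simps)
  finally show ?thesis
    using small[of q] small[of r] small[of s] assms by linarith
qed

text \<open>An entry above 1 would make the sum less than 4, so all entries are at most 1. Four
  terms that are each at most 1 sum to 4 only if each is 1.\<close>

lemma powr_four_thirds_sum_extremal:
  fixes p q r s :: real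
  assumes nonneg: "0 \<le> p" "0 \<le> q" "0 \<le> r" "0 \<le> s"
    and pairs: "p + q \<le> 2" "p + r \<le> 2" "p + s \<le> 2" "q + r \<le> 2" "q + s \<le> 2" "r + s \<le> 2"
    and eq: "p powr (4/3) + q powr (4/3) + r powr (4/3) + s powr (4/3) = 4"
  shows "p = 1 \<and> q = 1 \<and> r = 1 \<and> s = 1"
proof -
  have le: "p \<le> 1" "q \<le> 1" "r \<le> 1" "s \<le> 1"
    using powr_four_thirds_sum_less[of q r s p] powr_four_thirds_sum_less[of p r s q]
      powr_four_thirds_sum_less[of p q s r] powr_four_thirds_sum_less[of p q r s] assms
    by (auto simp: add_ac intro: ccontr)
  have "t powr (4/3) \<le> 1 \<and> (t < 1 \<longrightarrow> t powr (4/3) < 1)" if "0 \<le> t" "t \<le> 1" for t :: real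
    using that powr_mono2[of "4/3" t 1] powr_less_mono2[of "4/3" t 1] by auto
  from this[of p] this[of q] this[of r] this[of s] nonneg le eq show ?thesis
    by linarith
qed

lemma four_powr_three_quarters: "(4::real) powr (3/4) = 2 * sqrt 2"
proof -
  have "(4::real) powr (3/4) = (2 powr 2) powr (3/4)" by simp
  also have "\<dots> = 2 powr (1 + 1/2)" by (simp only: powr_powr) simp
  also have "\<dots> = 2 * sqrt 2" by (simp only: powr_add powr_half_sqrt) simp
  finally show ?thesis .
qed

lemma four_thirds_norm_extremal_iff:
  fixes a b c d :: real
  defines "M \<equiv> max (\<bar>a + b\<bar> + \<bar>c + d\<bar>) (\<bar>a - b\<bar> + \<bar>c - d\<bar>)"
  assumes nz: "\<not> (a = 0 \<and> b = 0 \<and> c = 0 \<and> d = 0)"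
  shows "(\<bar>a\<bar> powr (4/3) + \<bar>b\<bar> powr (4/3) + \<bar>c\<bar> powr (4/3) + \<bar>d\<bar> powr (4/3)) powr (3/4) = sqrt 2 * M
    \<longleftrightarrow> 2 * \<bar>a\<bar> = M \<and> 2 * \<bar>b\<bar> = M \<and> 2 * \<bar>c\<bar> = M \<and> 2 * \<bar>d\<bar> = M"
proof -
  define m where "m = M / 2"
  have M: "M = 2 * m" by (simp add: m_def)
  have avg: "max (2 * \<bar>u\<bar>) (2 * \<bar>v\<bar>) \<le> \<bar>u + v\<bar> + \<bar>u - v\<bar>" for u v :: real
    by linarith
  define P Q R U where "P = \<bar>a + b\<bar>" and "Q = \<bar>a - b\<bar>" and "R = \<bar>c + d\<bar>" and "U = \<bar>c - d\<bar>"
  have bounds: "P + R \<le> M" "Q + U \<le> M" "0 \<le> P" "0 \<le> Q" "0 \<le> R" "0 \<le> U"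
    by (simp_all add: M_def P_def Q_def R_def U_def)
  have row: "\<bar>a\<bar> + \<bar>b\<bar> \<le> max P Q" "\<bar>c\<bar> + \<bar>d\<bar> \<le> max R U"
    by (auto simp: P_def Q_def R_def U_def)
  have entry: "2 * \<bar>a\<bar> \<le> P + Q" "2 * \<bar>b\<bar> \<le> P + Q" "2 * \<bar>c\<bar> \<le> R + U" "2 * \<bar>d\<bar> \<le> R + U"
    using avg[of a b] avg[of c d] by (simp_all add: P_def Q_def R_def U_def)
  \<comment> \<open>Within a row, \<open>P\<close>, \<open>Q\<close>, \<open>R\<close> and
    \<open>U\<close> are each at most \<open>M\<close>. Across rows, twice the pair sum is at most
    \<open>(P + R) + (Q + U) \<le> 2 * M\<close>.\<close>
  have pairs: "\<bar>a\<bar> + \<bar>b\<bar> \<le> M" "\<bar>a\<bar> + \<bar>c\<bar> \<le> M" "\<bar>a\<bar> + \<bar>d\<bar> \<le> M"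
    "\<bar>b\<bar> + \<bar>c\<bar> \<le> M" "\<bar>b\<bar> + \<bar>d\<bar> \<le> M" "\<bar>c\<bar> + \<bar>d\<bar> \<le> M"
    using row entry bounds by linarith+
  \<comment> \<open>Otherwise the pair bounds would force every entry to vanish.\<close>
  have m: "0 < m"
    using nz pairs unfolding m_def by linarith
  \<comment> \<open>Scaling by \<open>m\<close> turns the pair bounds into the bound 2 of the
    extremal lemma, and \<open>m\<close> factors out of both sides of the equation.\<close>
  define S where "S = (\<bar>a\<bar> / m) powr (4/3) + (\<bar>b\<bar> / m) powr (4/3) + (\<bar>c\<bar> / m) powr (4/3) + (\<bar>d\<bar> / m) powr (4/3)"
  have "0 \<le> S" by (simp add: S_def)
  have "\<bar>a\<bar> powr (4/3) + \<bar>b\<bar> powr (4/3) + \<bar>c\<bar> powr (4/3) + \<bar>d\<bar> powr (4/3) = m powr (4/3) * S"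
    using m by (simp add: S_def powr_divide distrib_left)
  then have "(\<bar>a\<bar> powr (4/3) + \<bar>b\<bar> powr (4/3) + \<bar>c\<bar> powr (4/3) + \<bar>d\<bar> powr (4/3)) powr (3/4) = m * S powr (3/4)"
    using m \<open>0 \<le> S\<close> by (simp add: powr_mult powr_powr)
  moreover have "sqrt 2 * M = m * 4 powr (3/4)"
    by (simp add: M four_powr_three_quarters)
  moreover have "S powr (3/4) = 4 powr (3/4) \<longleftrightarrow> S = 4"
    using \<open>0 \<le> S\<close> powr_less_mono2[of "3/4" S 4] powr_less_mono2[of "3/4" 4 S]
    by (cases S "4::real" rule: linorder_cases) auto
  ultimately have "(\<bar>a\<bar> powr (4/3) + \<bar>b\<bar> powr (4/3) + \<bar>c\<bar> powr (4/3) + \<bar>d\<bar> powr (4/3)) powr (3/4) = sqrt 2 * M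
    \<longleftrightarrow> S = 4"
    using m by simp
  also have "\<dots> \<longleftrightarrow> \<bar>a\<bar> / m = 1 \<and> \<bar>b\<bar> / m = 1 \<and> \<bar>c\<bar> / m = 1 \<and> \<bar>d\<bar> / m = 1"
  proof
    have pair: "\<bar>u\<bar> / m + \<bar>v\<bar> / m \<le> 2" if "\<bar>u\<bar> + \<bar>v\<bar> \<le> M" for u v
      using that m by (simp add: M field_simps)
    assume "S = 4"
    then show "\<bar>a\<bar> / m = 1 \<and> \<bar>b\<bar> / m = 1 \<and> \<bar>c\<bar> / m = 1 \<and> \<bar>d\<bar> / m = 1"
      using m unfolding S_def
      by (intro powr_four_thirds_sum_extremal pair pairs) auto
  next
    assume "\<bar>a\<bar> / m = 1 \<and> \<bar>b\<bar> / m = 1 \<and> \<bar>c\<bar> / m = 1 \<and> \<bar>d\<bar> / m = 1"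
    then show "S = 4" unfolding S_def by (simp only: powr_one_eq_one)
  qed
  finally show ?thesis
    using m by (auto simp: M)
qed

text \<open>With equal moduli and an odd number of minus signs, each row contributes
  \<open>2 * \<bar>a\<bar>\<close> to one term of the maximum and 0 to the other, in opposite order,
  so \<open>M = 2 * \<bar>a\<bar>\<close>. With an even number the rows agree up to sign and
  \<open>M = 4 * \<bar>a\<bar>\<close>, which leaves only the zero form, covered here by \<alpha> =
  0.\<close>

lemma abs_eq_half_max_iff:
  fixes a b c d :: real
  defines "M \<equiv> max (\<bar>a + b\<bar> + \<bar>c + d\<bar>) (\<bar>a - b\<bar> + \<bar>c - d\<bar>)"
  shows "2 * \<bar>a\<bar> = M \<and> 2 * \<bar>b\<bar> = M \<and> 2 * \<bar>c\<bar> = M \<and> 2 * \<bar>d\<bar> = M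
    \<longleftrightarrow> (\<exists>\<alpha>. a = \<alpha> \<and> b = \<alpha> \<and> c = \<alpha> \<and> d = - \<alpha> \<or> a = \<alpha> \<and> b = \<alpha> \<and> c = - \<alpha> \<and> d = \<alpha>
           \<or> a = \<alpha> \<and> b = - \<alpha> \<and> c = \<alpha> \<and> d = \<alpha> \<or> a = - \<alpha> \<and> b = \<alpha> \<and> c = \<alpha> \<and> d = \<alpha>)"
    (is "?L \<longleftrightarrow> (\<exists>\<alpha>. ?R \<alpha>)")
proof
  assume ?L
  then have "b = a \<or> b = - a" "c = a \<or> c = - a" "d = a \<or> d = - a" and "2 * \<bar>a\<bar> = M"
    by (auto simp: abs_eq_iff)
  \<comment> \<open>The parameter is the common value of the three entries that agree:
    \<open>- a\<close> if \<open>a\<close> is the odd one out, and \<open>a\<close>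
    otherwise.\<close>
  then have "?R a \<or> ?R (- a)"
    unfolding M_def by (elim disjE) auto
  then show "\<exists>\<alpha>. ?R \<alpha>" by blast
next
  assume "\<exists>\<alpha>. ?R \<alpha>"
  then show ?L unfolding M_def by (elim exE disjE conjE) simp_all
qed

lemma bilinear_form_2_eq_iff:
  fixes T :: "real ^ 2 \<Rightarrow> real ^ 2 \<Rightarrow> real"
  assumes T: "\<And>x y. T x y = a * x $ 1 * y $ 1 + b * x $ 1 * y $ 2 + c * x $ 2 * y $ 1 + d * x $ 2 * y $ 2"
  shows "(\<forall>x y. T x y = a' * x $ 1 * y $ 1 + b' * x $ 1 * y $ 2 + c' * x $ 2 * y $ 1 + d' * x $ 2 * y $ 2)
    \<longleftrightarrow> a = a' \<and> b = b' \<and> c = c' \<and> d = d'" (is "?L \<longleftrightarrow> _")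
proof
  assume ?L
  then have "a * x $ 1 * y $ 1 + b * x $ 1 * y $ 2 + c * x $ 2 * y $ 1 + d * x $ 2 * y $ 2
    = a' * x $ 1 * y $ 1 + b' * x $ 1 * y $ 2 + c' * x $ 2 * y $ 1 + d' * x $ 2 * y $ 2" for x y :: "real ^ 2"
    by (simp add: T)
  from this[of "axis 1 1" "axis 1 1"] this[of "axis 1 1" "axis 2 1"]
    this[of "axis 2 1" "axis 1 1"] this[of "axis 2 1" "axis 2 1"]
  show "a = a' \<and> b = b' \<and> c = c' \<and> d = d'"
    by (simp add: axis_def)
qed (simp add: T)

theorem theorem4p1:
  fixes T :: "real ^ 2 \<Rightarrow> real ^ 2 \<Rightarrow> real" and a :: "2 \<Rightarrow> 2 \<Rightarrow> real"
  assumes "\<And>x y. T x y = (\<Sum>i\<in>UNIV. \<Sum>j\<in>UNIV. a i j * x $ i * y $ j)"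
  shows "(T \<noteq> (\<lambda>x y. 0) \<and>
          (\<Sum>j\<in>UNIV. \<Sum>k\<in>UNIV. \<bar>T (axis j 1) (axis k 1)\<bar> powr (4 / 3)) powr (3 / 4)
            = sqrt 2 * bilinear_form_norm T) \<longleftrightarrow>
         (\<exists>\<alpha>. \<alpha> \<noteq> 0 \<and>
           ((\<forall>x y. T x y = \<alpha> * x $ 1 * y $ 1 + \<alpha> * x $ 1 * y $ 2 + \<alpha> * x $ 2 * y $ 1 - \<alpha> * x $ 2 * y $ 2) \<or>
            (\<forall>x y. T x y = \<alpha> * x $ 1 * y $ 1 + \<alpha> * x $ 1 * y $ 2 - \<alpha> * x $ 2 * y $ 1 + \<alpha> * x $ 2 * y $ 2) \<or>
            (\<forall>x y. T x y = \<alpha> * x $ 1 * y $ 1 - \<alpha> * x $ 1 * y $ 2 + \<alpha> * x $ 2 * y $ 1 + \<alpha> * x $ 2 * y $ 2) \<or>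
            (\<forall>x y. T x y = - \<alpha> * x $ 1 * y $ 1 + \<alpha> * x $ 1 * y $ 2 + \<alpha> * x $ 2 * y $ 1 + \<alpha> * x $ 2 * y $ 2)))"
proof -
  define p q r s where "p = a 1 1" and "q = a 1 2" and "r = a 2 1" and "s = a 2 2"
  have T: "T x y = p * x $ 1 * y $ 1 + q * x $ 1 * y $ 2 + r * x $ 2 * y $ 1 + s * x $ 2 * y $ 2" for x y
    by (simp add: assms sum_2 p_def q_def r_def s_def)
  have zero: "T = (\<lambda>x y. 0) \<longleftrightarrow> p = 0 \<and> q = 0 \<and> r = 0 \<and> s = 0"
    using bilinear_form_2_eq_iff[of T, OF T, of 0 0 0 0] by (simp add: fun_eq_iff)
  have sum: "(\<Sum>j\<in>UNIV. \<Sum>k\<in>UNIV. \<bar>T (axis j 1) (axis k 1)\<bar> powr (4/3))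
    = \<bar>p\<bar> powr (4/3) + \<bar>q\<bar> powr (4/3) + \<bar>r\<bar> powr (4/3) + \<bar>s\<bar> powr (4/3)"
    by (simp add: T sum_2 axis_def)
  note eq_iff = bilinear_form_2_eq_iff[of T, OF T]
  have forms:
    "(\<forall>x y. T x y = \<alpha> * x $ 1 * y $ 1 + \<alpha> * x $ 1 * y $ 2 + \<alpha> * x $ 2 * y $ 1 - \<alpha> * x $ 2 * y $ 2)
      \<longleftrightarrow> p = \<alpha> \<and> q = \<alpha> \<and> r = \<alpha> \<and> s = - \<alpha>"
    "(\<forall>x y. T x y = \<alpha> * x $ 1 * y $ 1 + \<alpha> * x $ 1 * y $ 2 - \<alpha> * x $ 2 * y $ 1 + \<alpha> * x $ 2 * y $ 2)
      \<longleftrightarrow> p = \<alpha> \<and> q = \<alpha> \<and> r = - \<alpha> \<and> s = \<alpha>"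
    "(\<forall>x y. T x y = \<alpha> * x $ 1 * y $ 1 - \<alpha> * x $ 1 * y $ 2 + \<alpha> * x $ 2 * y $ 1 + \<alpha> * x $ 2 * y $ 2)
      \<longleftrightarrow> p = \<alpha> \<and> q = - \<alpha> \<and> r = \<alpha> \<and> s = \<alpha>"
    "(\<forall>x y. T x y = - \<alpha> * x $ 1 * y $ 1 + \<alpha> * x $ 1 * y $ 2 + \<alpha> * x $ 2 * y $ 1 + \<alpha> * x $ 2 * y $ 2)
      \<longleftrightarrow> p = - \<alpha> \<and> q = \<alpha> \<and> r = \<alpha> \<and> s = \<alpha>" for \<alpha>
    using eq_iff[of \<alpha> \<alpha> \<alpha> "- \<alpha>"] eq_iff[of \<alpha> \<alpha> "- \<alpha>" \<alpha>] eq_iff[of \<alpha> "- \<alpha>" \<alpha> \<alpha>] eq_iff[of "- \<alpha>" \<alpha> \<alpha> \<alpha>]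
    by simp_all
  show ?thesis
  proof (cases "p = 0 \<and> q = 0 \<and> r = 0 \<and> s = 0")
    case True
    \<comment> \<open>The zero form satisfies neither side: the left excludes it explicitly, and on
      the right it would force \<alpha> = 0.\<close>
    then show ?thesis unfolding forms using zero by auto
  next
    case False
    \<comment> \<open>The sign analysis admits \<alpha> = 0; this supplies the missing condition for
      a nonzero form.\<close>
    have "\<alpha> \<noteq> 0" if "p = \<alpha> \<or> p = - \<alpha>" "q = \<alpha> \<or> q = - \<alpha>" "r = \<alpha> \<or> r = - \<alpha>" "s = \<alpha> \<or> s = - \<alpha>" for \<alpha>
    proof
      assume "\<alpha> = 0"
      with that False show False by simp
    qed
    with False show ?thesis
      unfolding forms sum bilinear_form_norm_2[of T, OF T] zero
        four_thirds_norm_extremal_iff[OF False] abs_eq_half_max_iff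
      by blast
  qed
qed

end
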